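(* Consider the composite problem, the point $x_t$, and Algorithm 1 (W(R)PNO via a first-order weak proximal oracle) described in the context, and let $(y_i)_{i\ge1}$ be the sequence produced by Algorithm 1. (i) If Assumption A holds and $\phi_t=\phi_{x_t,1}$, then with the fixed step-size $\lambda_i=\frac{\alpha}{\tilde\beta}$ ($\alpha$ as in Assumption A), for all $i\ge1$, $$\phi_t(y_i)-\phi_t(x^* )\le\left(F(x_t)-F^*+\frac{\beta_2}{6}\|x_t-x^*\|^3\right)\left(1-\frac{\alpha}{\tilde\beta}\right)^{i-1}.$$ (ii) If Assumption B holds and $\phi_t=\phi^r_{x_t,1}$, then with the fixed step-size $\lambda_i=\frac{\alpha}{2\tilde\beta}$ ($\alpha$ as in Assumption B), for all $i\ge1$, $$\phi_t(y_i)-\phi_t(x^* )\le\left(F(x_t)-F^*\right)\left(1-\frac{\alpha}{4\tilde\beta}\right)^{i-1}+\frac{\beta_2}{3}\|x_t-x^*\|^3 .$$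
   Context: $E$ is a Euclidean vector space of dimension $n$ with inner product $\langle\cdot,\cdot\rangle$ and Euclidean norm $\|\cdot\|$ (for linear operators, the induced operator norm). $R:E\to(-\infty,\infty]$ is a proper closed convex function, $f$ is convex and twice continuously differentiable over $\mathrm{dom}(R)$, and $\|\nabla^2f(x)-\nabla^2f(y)\|\le\beta_2\|x-y\|$ for all $x,y\in\mathrm{dom}(R)$. The problem is to minimize $F=f+R$ over $E$; $F$ is bounded below, with optimal value $F^*$ and unique minimizer $x^*$. Assumption A: given an initialization point $x_1\in\mathrm{dom}(R)$, there are $\alpha,\beta>0$ such that for every $x$ in $\mathcal L_1=\{x\in E: F(x)\le F(x_1)\}$ it holds that $\beta I\succeq\nabla^2f(x)\succeq\alpha I$. Assumption B: $\mathrm{dom}(R)$ is bounded with Euclidean diameter $D<\infty$, and for some $\alpha>0$, $\|x-x^*\|^2\le\frac2\alpha(F(x)-F^* )$ for all $x\in\mathrm{dom}(R)$, where $x^*$ is the unique minimizer of $F$. In this case $\beta$ denotes the Lipschitz constant of $\nabla f$ over $\mathrm{dom}(R)$. $x_t\in\mathrm{dom}(R)$ is a fixed point (an iterate of a method that started at $x_1$ and never increases $F$, so $F(x_t)\le F(x_1)$). Define $$\phi_{x,1}(w)=\langle w-x,\nabla f(x)\rangle+\frac12\langle w-x,\nabla^2f(x)(w-x)\rangle+R(w),\qquad \phi^r_{x,1}(w)=\phi_{x,1}(w)+\frac{\beta_2}{6}\|w-x\|^3 .$$ Under Assumption A, $\phi_t=\phi_{x_t,1}$; under Assumption B, $\phi_t=\phi^r_{x_t,1}$.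 In each case $Q_t$ denotes the differentiable part of $\phi_t$ (i.e. the formula without the term $R(w)$). The constant $\tilde\beta$ denotes the Lipschitz constant of $\nabla Q_t$ over $\mathrm{dom}(R)$, and is set to $\tilde\beta=\beta$ if Assumption A holds and to $\tilde\beta=\beta+\frac{\beta_2D}{2}$ if Assumption B holds. First-order weak proximal oracle (WPO) for $\phi_t$: a map $\mathcal A_1:\mathrm{dom}(R)\times\mathbb R_+\to\mathrm{dom}(R)$ which, given $(y,\lambda)$, outputs $w\in\mathrm{dom}(R)$ with $\psi_{y,\lambda}(w)\le\min\{\psi_{y,\lambda}(x^* ),\psi_{y,\lambda}(y)\}$, where $$\psi_{y,\lambda}(z)=\langle z-y,\nabla Q_t(y)\rangle+\frac{\lambda\tilde\beta}{2}\|z-y\|^2+R(z).$$ Algorithm 1: input a WPO $\mathcal A_1$ and $x_t\in\mathrm{dom}(R)$; set $y_1=x_t$; for $i=1,2,\dots$: choose a step-size $\lambda_i\in[0,1]$, let $w_i=\mathcal A_1(y_i,\lambda_i)$ and $y_{i+1}=(1-\lambda_i)y_i+\lambda_iw_i$.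
   Formalization: In (ii), that ∇Q_t is β̃-Lipschitz over dom(R) with β̃=β+β₂D/2 is an explicit hypothesis, β being any Lipschitz constant of ∇f: it can fail, e.g. f=z³/6, R=z² on [0,1], x_t=1, where β̃=3/2 but Q_t'' reaches 2. *)

theory Defs
  imports "HOL-Analysis.Analysis"
begin

subsection \<open>Gradients and Hessians\<close>

definition gradient :: "('a::euclidean_space \<Rightarrow> real) \<Rightarrow> 'a \<Rightarrow> 'a" where
  "gradient f x = (THE g. GDERIV f x :> g)"

text \<open>The Hessian is a bounded linear operator, so that its norm is the operator norm induced by
  the Euclidean norm.\<close>

definition hessian :: "('a::euclidean_space \<Rightarrow> real) \<Rightarrow> 'a \<Rightarrow> 'a \<Rightarrow>\<^sub>L 'a" where
  "hessian f x = Blinfun (frechet_derivative (gradient f) (at x))"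

text \<open>The set \<open>S\<close> need not be open. The derivatives at a point of \<open>S\<close> are full derivatives
  in the ambient space, so \<open>f\<close> has to be differentiable in a neighbourhood of each point of \<open>S\<close>.\<close>

definition twice_cont_diff_on :: "('a::euclidean_space \<Rightarrow> real) \<Rightarrow> 'a set \<Rightarrow> bool" where
  "twice_cont_diff_on f S \<longleftrightarrow>
     (\<forall>x\<in>S. (\<forall>\<^sub>F z in nhds x. f differentiable (at z)) \<and> gradient f differentiable (at x)) \<and>
     continuous_on S (hessian f)"

definition loewner_le :: "('a::euclidean_space \<Rightarrow>\<^sub>L 'a) \<Rightarrow> ('a \<Rightarrow>\<^sub>L 'a) \<Rightarrow> bool" where
  "loewner_le A B \<longleftrightarrow> (\<forall>v. v \<bullet> blinfun_apply A v \<le> v \<bullet> blinfun_apply B v)"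


subsection \<open>Extended-valued convex functions\<close>

definition effdom :: "('a \<Rightarrow> ereal) \<Rightarrow> 'a set" where
  "effdom R = {x. R x < \<infinity>}"

definition ereal_epigraph :: "('a \<Rightarrow> ereal) \<Rightarrow> ('a \<times> real) set" where
  "ereal_epigraph R = {(x, t). R x \<le> ereal t}"

definition proper_closed_convex :: "('a::euclidean_space \<Rightarrow> ereal) \<Rightarrow> bool" where
  "proper_closed_convex R \<longleftrightarrow>
     (\<forall>x. R x \<noteq> -\<infinity>) \<and> effdom R \<noteq> {} \<and> closed (ereal_epigraph R) \<and> convex (ereal_epigraph R)"


subsection \<open>The composite problem\<close>

definition composite :: "('a \<Rightarrow> real) \<Rightarrow> ('a \<Rightarrow> ereal) \<Rightarrow> 'a \<Rightarrow> ereal" where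
  "composite f R x = ereal (f x) + R x"

definition opt_value :: "('a \<Rightarrow> real) \<Rightarrow> ('a \<Rightarrow> ereal) \<Rightarrow> ereal" where
  "opt_value f R = (INF x. composite f R x)"

definition unique_minimizer :: "('a \<Rightarrow> ereal) \<Rightarrow> 'a \<Rightarrow> bool" where
  "unique_minimizer F x \<longleftrightarrow> (\<forall>z. F x \<le> F z) \<and> (\<forall>y. (\<forall>z. F y \<le> F z) \<longrightarrow> y = x)"

definition composite_problem ::
    "('a::euclidean_space \<Rightarrow> real) \<Rightarrow> ('a \<Rightarrow> ereal) \<Rightarrow> real \<Rightarrow> 'a \<Rightarrow> bool" where
  "composite_problem f R \<beta>2 xstar \<longleftrightarrow>
     proper_closed_convex R \<and>
     convex_on (effdom R) f \<and>
     twice_cont_diff_on f (effdom R) \<and>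
     (\<forall>x\<in>effdom R. \<forall>y\<in>effdom R. norm (hessian f x - hessian f y) \<le> \<beta>2 * norm (x - y)) \<and>
     (\<exists>c::real. \<forall>x. ereal c \<le> composite f R x) \<and>
     unique_minimizer (composite f R) xstar"

definition assumption_A ::
    "('a::euclidean_space \<Rightarrow> real) \<Rightarrow> ('a \<Rightarrow> ereal) \<Rightarrow> 'a \<Rightarrow> real \<Rightarrow> real \<Rightarrow> bool" where
  "assumption_A f R x1 \<alpha> \<beta> \<longleftrightarrow>
     0 < \<alpha> \<and> 0 < \<beta> \<and>
     (\<forall>x. composite f R x \<le> composite f R x1 \<longrightarrow>
        loewner_le (hessian f x) (\<beta> *\<^sub>R id_blinfun) \<and> loewner_le (\<alpha> *\<^sub>R id_blinfun) (hessian f x))"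

definition assumption_B ::
    "('a::euclidean_space \<Rightarrow> real) \<Rightarrow> ('a \<Rightarrow> ereal) \<Rightarrow> 'a \<Rightarrow> real \<Rightarrow> real \<Rightarrow> bool" where
  "assumption_B f R xstar \<alpha> \<beta> \<longleftrightarrow>
     bounded (effdom R) \<and> 0 < \<alpha> \<and>
     (\<forall>x\<in>effdom R. ereal ((norm (x - xstar))\<^sup>2)
         \<le> ereal (2 / \<alpha>) * (composite f R x - opt_value f R)) \<and>
     \<beta>-lipschitz_on (effdom R) (gradient f)"


subsection \<open>Second-order models\<close>

text \<open>These are the differentiable parts of the two models; the models themselves are
  \<open>composite (quad_part f x) R\<close> and \<open>composite (cubic_part f \<beta>2 x) R\<close>.\<close>

definition quad_part :: "('a::euclidean_space \<Rightarrow> real) \<Rightarrow> 'a \<Rightarrow> 'a \<Rightarrow> real" where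
  "quad_part f x w =
     (w - x) \<bullet> gradient f x + 1 / 2 * ((w - x) \<bullet> blinfun_apply (hessian f x) (w - x))"

definition cubic_part :: "('a::euclidean_space \<Rightarrow> real) \<Rightarrow> real \<Rightarrow> 'a \<Rightarrow> 'a \<Rightarrow> real" where
  "cubic_part f \<beta>2 x w = quad_part f x w + \<beta>2 / 6 * norm (w - x) ^ 3"


subsection \<open>The weak proximal oracle and the algorithm\<close>

definition prox_objective ::
    "('a::euclidean_space \<Rightarrow> real) \<Rightarrow> ('a \<Rightarrow> ereal) \<Rightarrow> real \<Rightarrow> 'a \<Rightarrow> real \<Rightarrow> 'a \<Rightarrow> ereal" where
  "prox_objective Q R \<beta>t y \<eta> z =
     ereal ((z - y) \<bullet> gradient Q y + \<eta> * \<beta>t / 2 * (norm (z - y))\<^sup>2) + R z"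

definition weak_prox_oracle ::
    "('a::euclidean_space \<Rightarrow> real) \<Rightarrow> ('a \<Rightarrow> ereal) \<Rightarrow> real \<Rightarrow> 'a \<Rightarrow> ('a \<Rightarrow> real \<Rightarrow> 'a) \<Rightarrow> bool" where
  "weak_prox_oracle Q R \<beta>t xstar \<A> \<longleftrightarrow>
     (\<forall>y\<in>effdom R. \<forall>\<eta>\<ge>0. \<A> y \<eta> \<in> effdom R \<and>
        prox_objective Q R \<beta>t y \<eta> (\<A> y \<eta>)
          \<le> min (prox_objective Q R \<beta>t y \<eta> xstar) (prox_objective Q R \<beta>t y \<eta> y))"

text \<open>Iterates and step-sizes are indexed from 1; the values at index 0 are irrelevant.\<close>

definition wpno_run ::
    "('a::euclidean_space \<Rightarrow> real \<Rightarrow> 'a) \<Rightarrow> 'a \<Rightarrow> (nat \<Rightarrow> real) \<Rightarrow> (nat \<Rightarrow> 'a) \<Rightarrow> bool" where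
  "wpno_run \<A> xt \<eta> y \<longleftrightarrow>
     y 1 = xt \<and>
     (\<forall>i\<ge>1. 0 \<le> \<eta> i \<and> \<eta> i \<le> 1 \<and>
        y (Suc i) = (1 - \<eta> i) *\<^sub>R y i + \<eta> i *\<^sub>R \<A> (y i) (\<eta> i))"

end

theory Submission
  imports Defs
begin

text \<open>
  Write \<open>\<phi> = Q + R\<close> for the model, \<open>d = xstar - xt\<close>, and let \<open>L\<close> be the smoothness constant of \<open>Q\<close>.
  Comparing the oracle's output with \<open>xstar\<close> and using convexity of \<open>R\<close>, one step with step-size
  \<open>l\<close> gives
  \<open>\<phi> y' \<le> (1 - l) * (\<phi> y) + l * (Q y + (xstar - y) \<bullet> gradient Q y + l * L / 2 * norm (xstar - y)^2 + R xstar)\<close>.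
  In case A the choice \<open>l * L = \<alpha>\<close> makes the last bracket a strong convexity lower bound of
  \<open>\<phi> xstar\<close>. In case B only convexity of \<open>Q\<close> is available, and the remaining quadratic term is
  bounded by the quadratic growth of \<open>F\<close>, which the second-order Taylor estimate transfers to \<open>\<phi>\<close> up
  to the error \<open>\<beta>2 / 3 * norm d ^ 3\<close>.

  The domain of \<open>R\<close> may have empty interior, so the Hessian at \<open>xt\<close> is only known to be positive
  semidefinite along differences of points of the domain. This is obtained by shrinking such a
  difference towards \<open>xt\<close> and using the Lipschitz continuity of the Hessian.\<close>

subsection \<open>Gradients, Hessians and restrictions to lines\<close>

text \<open>\<open>gradient\<close> is a definite description, so existence and uniqueness are both
  required. The adjoint of the derivative at 1 supplies the representing vector.\<close>

lemma gderiv_gradient: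
  fixes f :: "'a::euclidean_space \<Rightarrow> real"
  assumes "f differentiable (at x)"
  shows "GDERIV f x :> gradient f x"
proof -
  obtain F where F: "(f has_derivative F) (at x)"
    using assms by (auto simp: differentiable_def)
  then have lin: "bounded_linear F"
    by (rule has_derivative_bounded_linear)
  define g where "g = adjoint F 1"
  have "F h = h \<bullet> g" for h
    using adjoint_works[OF bounded_linear.linear[OF lin], of h 1] by (simp add: g_def)
  then have "F = (\<lambda>h. h \<bullet> g)"
    by blast
  then have g: "GDERIV f x :> g"
    using F by (simp add: gderiv_def)
  have "g' = g" if "GDERIV f x :> g'" for g'
  proof -
    have "(\<lambda>h. h \<bullet> g') = (\<lambda>h. h \<bullet> g)"
      using has_derivative_unique that g unfolding gderiv_def by blast
    then show ?thesis
      by (metis inner_commute vector_eq_ldot)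
  qed
  with g show ?thesis
    unfolding gradient_def by (rule theI)
qed

text \<open>Gradients of the models occur only inside inner products, so this evaluates them from a
  derivative without writing out the gradient vector.\<close>

lemma inner_gradient:
  fixes f :: "'a::euclidean_space \<Rightarrow> real"
  assumes "(f has_derivative F) (at x)"
  shows "v \<bullet> gradient f x = F v"
proof -
  have "GDERIV f x :> gradient f x"
    using assms gderiv_gradient differentiableI by blast
  then have "(\<lambda>h. h \<bullet> gradient f x) = F"
    using assms has_derivative_unique unfolding gderiv_def by blast
  then show ?thesis
    by metis
qed

lemma has_derivative_hessian:
  fixes f :: "'a::euclidean_space \<Rightarrow> real"
  assumes "gradient f differentiable (at x)"
  shows "(gradient f has_derivative blinfun_apply (hessian f x)) (at x)"
  using assms unfolding hessian_def frechet_derivative_works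
  by (simp add: bounded_linear_Blinfun_apply has_derivative_bounded_linear)

lemma has_derivative_line:
  fixes f :: "'a::real_normed_vector \<Rightarrow> 'b::real_normed_vector"
  assumes "(f has_derivative F) (at (x + s *\<^sub>R d))"
  shows "((\<lambda>s. f (x + s *\<^sub>R d)) has_derivative (\<lambda>t. t *\<^sub>R F d)) (at s)"
proof -
  have "((\<lambda>s. x + s *\<^sub>R d) has_derivative (\<lambda>t. t *\<^sub>R d)) (at s)"
    by (auto intro!: derivative_eq_intros)
  from has_derivative_compose[OF this assms] show ?thesis
    by (simp add: linear_scale has_derivative_linear[OF assms])
qed

lemma DERIV_line:
  fixes f :: "'a::euclidean_space \<Rightarrow> real"
  assumes "f differentiable (at (x + s *\<^sub>R d))"
  shows "((\<lambda>s. f (x + s *\<^sub>R d)) has_real_derivative d \<bullet> gradient f (x + s *\<^sub>R d)) (at s)"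
  using has_derivative_line[OF gderiv_gradient[OF assms, unfolded gderiv_def]]
  by (simp add: has_field_derivative_def mult_commute_abs)

lemma DERIV_gradient_line:
  fixes f :: "'a::euclidean_space \<Rightarrow> real"
  assumes "gradient f differentiable (at (x + s *\<^sub>R d))"
  shows "((\<lambda>s. d \<bullet> gradient f (x + s *\<^sub>R d)) has_real_derivative
           d \<bullet> hessian f (x + s *\<^sub>R d) d) (at s)"
  using has_derivative_inner_right[OF has_derivative_line[OF has_derivative_hessian[OF assms]], of d]
  by (simp add: has_field_derivative_def mult_commute_abs)

lemma segment_mem:
  fixes S :: "'a::real_vector set"
  assumes "convex S" "x \<in> S" "z \<in> S" "0 \<le> s" "s \<le> (1::real)"
  shows "x + s *\<^sub>R (z - x) \<in> S"
  using convexD_alt[OF assms] by (simp add: algebra_simps)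


subsection \<open>Taylor estimates\<close>

lemma taylor2_unit_interval:
  fixes h h' h'' :: "real \<Rightarrow> real"
  assumes h: "\<And>s. 0 \<le> s \<Longrightarrow> s \<le> 1 \<Longrightarrow> (h has_real_derivative h' s) (at s)"
    and h': "\<And>s. 0 \<le> s \<Longrightarrow> s \<le> 1 \<Longrightarrow> (h' has_real_derivative h'' s) (at s)"
    and h'': "\<And>s. 0 \<le> s \<Longrightarrow> s \<le> 1 \<Longrightarrow> h'' s \<le> h'' 0 + M * s"
  shows "h 1 \<le> h 0 + h' 0 + h'' 0 / 2 + M / 6"
proof -
  \<comment> \<open>\<open>m\<close> and \<open>k\<close> are the remainders of \<open>h'\<close>
    and \<open>h\<close> after subtracting the polynomials obtained by integrating the bound on
    \<open>h''\<close>. Thus \<open>k' = m\<close> and \<open>m' \<le> 0\<close>, and two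
    monotonicity arguments replace integration.\<close>
  define m where "m s = h' s - h' 0 - s * h'' 0 - M * s\<^sup>2 / 2" for s
  define k where "k s = h s - s * h' 0 - s\<^sup>2 / 2 * h'' 0 - M * s ^ 3 / 6" for s
  have dm: "(m has_real_derivative h'' s - h'' 0 - M * s) (at s)" if "0 \<le> s" "s \<le> 1" for s
    unfolding m_def by (auto intro!: derivative_eq_intros h' that)
  have m: "m s \<le> 0" if s: "0 \<le> s" "s \<le> 1" for s
  proof -
    have "m s \<le> m 0"
    proof (rule DERIV_nonpos_imp_nonincreasing[OF s(1)])
      show "\<exists>y. (m has_real_derivative y) (at t) \<and> y \<le> 0" if "0 \<le> t" "t \<le> s" for t
        using dm[of t] h''[of t] that s by force
    qed
    then show ?thesis
      by (simp add: m_def)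
  qed
  have dk: "(k has_real_derivative m s) (at s)" if "0 \<le> s" "s \<le> 1" for s
    unfolding k_def m_def
    by (auto intro!: derivative_eq_intros h that simp: field_simps power2_eq_square)
  have "k 1 \<le> k 0"
    by (rule DERIV_nonpos_imp_nonincreasing) (use dk m in force)+
  then show ?thesis
    by (simp add: k_def)
qed

lemma hessian_form_diff_le:
  fixes f :: "'a::euclidean_space \<Rightarrow> real"
  assumes "norm (hessian f x - hessian f z) \<le> c"
  shows "\<bar>d \<bullet> hessian f x d - d \<bullet> hessian f z d\<bar> \<le> c * (norm d)\<^sup>2"
proof -
  have "\<bar>d \<bullet> hessian f x d - d \<bullet> hessian f z d\<bar> = \<bar>d \<bullet> (hessian f x - hessian f z) d\<bar>"
    by (simp add: blinfun.diff_left inner_diff_right)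
  also have "\<dots> \<le> norm d * norm ((hessian f x - hessian f z) d)"
    by (rule Cauchy_Schwarz_ineq2)
  also have "\<dots> \<le> norm d * (norm (hessian f x - hessian f z) * norm d)"
    by (intro mult_left_mono norm_blinfun norm_ge_zero)
  also have "\<dots> \<le> norm d * (c * norm d)"
    by (intro mult_left_mono mult_right_mono assms norm_ge_zero)
  finally show ?thesis
    by (simp add: power2_eq_square mult_ac)
qed

text \<open>Convexity is known on \<open>S\<close> only, so the derivative is taken as a one-sided
  limit of difference quotients along the segment; convexity bounds each quotient by
  \<open>f q - f p\<close>.\<close>

lemma convex_on_imp_above_tangent_gradient:
  fixes f :: "'a::euclidean_space \<Rightarrow> real"
  assumes f: "convex_on S f" and diff: "f differentiable (at p)" and p: "p \<in> S" and q: "q \<in> S"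
  shows "(q - p) \<bullet> gradient f p \<le> f q - f p"
proof -
  define h where "h s = f (p + s *\<^sub>R (q - p))" for s
  have "(h has_real_derivative (q - p) \<bullet> gradient f p) (at 0)"
    unfolding h_def using DERIV_line[of f p 0 "q - p"] diff by simp
  then have "((\<lambda>s. (h s - h 0) / s) \<longlongrightarrow> (q - p) \<bullet> gradient f p) (at_right 0)"
    by (simp add: DERIV_def filterlim_at_split)
  moreover have "\<forall>\<^sub>F s in at_right 0. (h s - h 0) / s \<le> f q - f p"
  proof (rule eventually_mono[OF eventually_at_right_real[of 0 "1::real"]])
    fix s :: real
    assume s: "s \<in> {0<..<1}"
    have "h s \<le> (1 - s) * f p + s * f q"
      unfolding h_def using convex_onD[OF f, of s p q] s p q by (simp add: algebra_simps)
    then show "(h s - h 0) / s \<le> f q - f p"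
      using s by (simp add: h_def pos_divide_le_eq) (simp add: algebra_simps)
  qed simp
  ultimately show ?thesis
    by (intro tendsto_upperbound) auto
qed

locale convex_lipschitz_hessian =
  fixes f :: "'a::euclidean_space \<Rightarrow> real" and S :: "'a set" and \<beta>2 :: real
  assumes conv: "convex_on S f"
    and diff: "twice_cont_diff_on f S"
    and lip: "\<And>x z. x \<in> S \<Longrightarrow> z \<in> S \<Longrightarrow> norm (hessian f x - hessian f z) \<le> \<beta>2 * norm (x - z)"
begin

lemma convex_S: "convex S"
  using conv by (rule convex_on_imp_convex)

lemma differentiable_at: "x \<in> S \<Longrightarrow> f differentiable (at x)"
  using diff eventually_nhds_x_imp_x unfolding twice_cont_diff_on_def by blast

text \<open>Along the segment the second derivative of \<open>f\<close> drifts from its initial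
  value by at most \<open>M * s\<close>: two factors \<open>norm d\<close> come from the quadratic
  form and one from the distance to \<open>x\<close>. The one-sided Taylor bound is applied to
  \<open>h\<close> and to \<open>- h\<close>.\<close>

lemma quad_part_approx:
  assumes x: "x \<in> S" and z: "z \<in> S"
  shows "\<bar>f z - f x - quad_part f x z\<bar> \<le> \<beta>2 / 6 * norm (z - x) ^ 3"
proof -
  define d where "d = z - x"
  define M where "M = \<beta>2 * norm d ^ 3"
  define h where "h s = f (x + s *\<^sub>R d)" for s
  define h' where "h' s = d \<bullet> gradient f (x + s *\<^sub>R d)" for s
  define h'' where "h'' s = d \<bullet> hessian f (x + s *\<^sub>R d) d" for s
  have seg: "x + s *\<^sub>R d \<in> S" if "0 \<le> s" "s \<le> 1" for s
    unfolding d_def using convex_S x z that by (rule segment_mem)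
  have dh: "(h has_real_derivative h' s) (at s)" if "0 \<le> s" "s \<le> 1" for s
    unfolding h_def h'_def using seg[OF that] by (intro DERIV_line differentiable_at)
  have dh': "(h' has_real_derivative h'' s) (at s)" if "0 \<le> s" "s \<le> 1" for s
    unfolding h'_def h''_def
    using diff seg[OF that] unfolding twice_cont_diff_on_def by (intro DERIV_gradient_line) blast
  have h'': "\<bar>h'' s - h'' 0\<bar> \<le> M * s" if "0 \<le> s" "s \<le> 1" for s
  proof -
    have "norm (hessian f (x + s *\<^sub>R d) - hessian f x) \<le> \<beta>2 * (s * norm d)"
      using lip[OF seg[OF that] x] that by simp
    from hessian_form_diff_le[OF this, of d] show ?thesis
      unfolding h''_def M_def by (simp add: power2_eq_square power3_eq_cube mult_ac)
  qed
  have h''_le: "h'' s \<le> h'' 0 + M * s" "- h'' s \<le> - h'' 0 + M * s" if "0 \<le> s" "s \<le> 1" for s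
    using h''[OF that] by linarith+
  have up: "h 1 \<le> h 0 + h' 0 + h'' 0 / 2 + M / 6"
    using dh dh' h''_le(1) by (rule taylor2_unit_interval)
  have lo: "- h 1 \<le> - h 0 + - h' 0 + - h'' 0 / 2 + M / 6"
    by (rule taylor2_unit_interval[where h = "\<lambda>s. - h s" and h' = "\<lambda>s. - h' s"
          and h'' = "\<lambda>s. - h'' s"])
       (use dh dh' h''_le(2) in \<open>auto intro!: DERIV_minus\<close>)
  have "h 1 = f z" "h 0 = f x" "quad_part f x z = h' 0 + h'' 0 / 2"
    by (simp_all add: h_def h'_def h''_def quad_part_def d_def)
  moreover have "M / 6 = \<beta>2 / 6 * norm (z - x) ^ 3"
    by (simp add: M_def d_def)
  ultimately show ?thesis
    using up lo by linarith
qed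

lemma hessian_psd:
  assumes x: "x \<in> S" and u: "u \<in> S" and v: "v \<in> S"
  shows "0 \<le> (v - u) \<bullet> hessian f x (v - u)"
proof -
  define d where "d = v - u"
  \<comment> \<open>\<open>C\<close> collects two errors, each of order \<open>s\<close> after
    division by \<open>s\<^sup>2 / 2\<close>: the change of the Hessian from \<open>x\<close> to
    \<open>p\<close>, and the cubic Taylor remainder between \<open>p\<close> and \<open>q\<close>.
    Both vanish as \<open>s\<close> tends to 0.\<close>
  define C where "C = \<beta>2 * norm (u - x) * (norm d)\<^sup>2 + \<beta>2 / 3 * norm d ^ 3"
  have *: "0 \<le> d \<bullet> hessian f x d + s * C" if s: "0 < s" "s < 1" for s
  proof -
    define p where "p = x + s *\<^sub>R (u - x)"
    define q where "q = x + s *\<^sub>R (v - x)"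
    have pq: "p \<in> S" "q \<in> S"
      unfolding p_def q_def using convex_S x u v s by (auto intro!: segment_mem)
    have qp: "q - p = s *\<^sub>R d"
      by (simp add: p_def q_def d_def algebra_simps)
    have "norm (hessian f p - hessian f x) \<le> \<beta>2 * (s * norm (u - x))"
      using lip[OF pq(1) x] s by (simp add: p_def)
    from hessian_form_diff_le[OF this, of d]
    have H: "d \<bullet> hessian f p d \<le> d \<bullet> hessian f x d + \<beta>2 * (s * norm (u - x)) * (norm d)\<^sup>2"
      by linarith
    have "0 \<le> f q - f p - (q - p) \<bullet> gradient f p"
      using convex_on_imp_above_tangent_gradient[OF conv differentiable_at] pq by simp
    also have "\<dots> \<le> 1 / 2 * ((q - p) \<bullet> hessian f p (q - p)) + \<beta>2 / 6 * norm (q - p) ^ 3"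
      using quad_part_approx[OF pq] unfolding quad_part_def by linarith
    also have "\<dots> = s\<^sup>2 / 2 * (d \<bullet> hessian f p d + s * (\<beta>2 / 3 * norm d ^ 3))"
      using s by (simp add: qp blinfun.scaleR_right power2_eq_square power3_eq_cube algebra_simps)
    finally have "0 \<le> d \<bullet> hessian f p d + s * (\<beta>2 / 3 * norm d ^ 3)"
      using s by (simp add: zero_le_mult_iff)
    with H show ?thesis
      by (simp add: C_def algebra_simps)
  qed
  have "((\<lambda>s. d \<bullet> hessian f x d + s * C) \<longlongrightarrow> d \<bullet> hessian f x d + 0 * C) (at_right 0)"
    by (intro tendsto_intros)
  moreover have "\<forall>\<^sub>F s in at_right 0. 0 \<le> d \<bullet> hessian f x d + s * C"
    using eventually_at_right_real[of 0 "1::real"] * by (auto elim: eventually_mono)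
  ultimately have "0 \<le> d \<bullet> hessian f x d + 0 * C"
    by (intro tendsto_lowerbound) auto
  then show ?thesis
    by (simp add: d_def)
qed

text \<open>The sign of \<beta>2 is not assumed; two distinct points of \<open>S\<close> force it.
  If the points coincide, the estimates that depend on it are trivial, which explains the later case
  splits.\<close>

lemma lipschitz_const_nonneg:
  assumes "x \<in> S" "z \<in> S" "x \<noteq> z"
  shows "0 \<le> \<beta>2"
  using order_trans[OF norm_ge_zero lip[OF assms(1,2)]] assms(3)
  by (simp add: zero_le_mult_iff)

end


subsection \<open>The second-order models\<close>

text \<open>The norm is not differentiable at its centre, but its cube is, with derivative 0. There
  the difference quotient is the squared norm; elsewhere the chain rule applies.\<close>

lemma has_derivative_norm_cube:
  fixes x u :: "'a::real_inner"
  shows "((\<lambda>w. norm (w - x) ^ 3) has_derivative (\<lambda>h. 3 * norm (u - x) * (h \<bullet> (u - x)))) (at u)"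
proof (cases "u = x")
  case True
  have "((\<lambda>y. (norm (y - x))\<^sup>2) \<longlongrightarrow> (norm (x - x))\<^sup>2) (at x)"
    by (intro tendsto_intros)
  moreover have "norm (norm (y - x) ^ 3) / norm (y - x) = (norm (y - x))\<^sup>2" for y
    by (simp add: power2_eq_square power3_eq_cube)
  ultimately show ?thesis
    using True by (simp add: has_derivative_iff_norm)
next
  case False
  have "((\<lambda>w. norm (w - x)) has_derivative (\<lambda>h. h \<bullet> sgn (u - x))) (at u)"
    by (rule has_derivative_compose[where f = "\<lambda>w. w - x" and f' = "\<lambda>h. h"])
       (use False in \<open>auto intro!: derivative_eq_intros has_derivative_norm\<close>)
  from has_derivative_power[OF this, of 3]
  have "((\<lambda>w. norm (w - x) ^ 3) has_derivative
      (\<lambda>h. 3 * (h \<bullet> sgn (u - x)) * (norm (u - x))\<^sup>2)) (at u)"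
    by simp
  moreover have "3 * (h \<bullet> sgn (u - x)) * (norm (u - x))\<^sup>2 = 3 * norm (u - x) * (h \<bullet> (u - x))" for h
    using False by (simp add: sgn_div_norm power2_eq_square)
  ultimately show ?thesis
    by simp
qed

text \<open>The two mixed terms are kept separate: they are exactly the cross terms in the expansion
  of the quadratic form around \<open>u\<close>.\<close>

lemma has_derivative_quad_part:
  "(quad_part f x has_derivative
     (\<lambda>h. h \<bullet> gradient f x + 1 / 2 * (h \<bullet> hessian f x (u - x) + (u - x) \<bullet> hessian f x h))) (at u)"
proof -
  have "((\<lambda>w. hessian f x (w - x)) has_derivative (\<lambda>h. hessian f x h)) (at u)"
    by (auto intro!: derivative_eq_intros)
  then show ?thesis
    unfolding quad_part_def[abs_def]
    by (auto intro!: derivative_eq_intros simp: algebra_simps)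
qed

lemma has_derivative_cubic_part:
  "(cubic_part f \<beta>2 x has_derivative
     (\<lambda>h. h \<bullet> gradient f x + 1 / 2 * (h \<bullet> hessian f x (u - x) + (u - x) \<bullet> hessian f x h)
          + \<beta>2 / 6 * (3 * norm (u - x) * (h \<bullet> (u - x))))) (at u)"
  unfolding cubic_part_def[abs_def]
  by (intro derivative_intros has_derivative_quad_part has_derivative_norm_cube)

text \<open>Taylor's formula is exact for a quadratic. Bounds on the Hessian form at
  \<open>x\<close> therefore become smoothness, strong convexity or convexity of the model at every
  base point \<open>u\<close>.\<close>

lemma quad_part_expansion:
  "quad_part f x v = quad_part f x u + (v - u) \<bullet> gradient (quad_part f x) u
     + 1 / 2 * ((v - u) \<bullet> hessian f x (v - u))"
proof -
  define d e where "d = v - u" and "e = u - x"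
  have v: "v - x = d + e"
    by (simp add: d_def e_def)
  have "(d + e) \<bullet> hessian f x (d + e) = d \<bullet> hessian f x d + d \<bullet> hessian f x e
      + e \<bullet> hessian f x d + e \<bullet> hessian f x e"
    by (simp add: blinfun.add_right inner_add_left inner_add_right)
  then show ?thesis
    unfolding inner_gradient[OF has_derivative_quad_part] quad_part_def
      v d_def[symmetric] e_def[symmetric]
    by (simp only: inner_add_left[of d e "gradient f x"] distrib_left add_ac)
qed

text \<open>Cauchy-Schwarz reduces the claim to nonnegative numbers, where the gap is
  \<open>s^3 - 3 * t^2 * s + 2 * t^3 = (s - t)^2 * (s + 2 * t)\<close> with
  \<open>s = norm b\<close> and \<open>t = norm a\<close>.\<close>

lemma norm_cube_above_tangent:
  fixes a b :: "'a::real_inner"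
  shows "norm a ^ 3 + 3 * norm a * ((b - a) \<bullet> a) \<le> norm b ^ 3"
proof -
  have "(b - a) \<bullet> a \<le> norm a * norm b - (norm a)\<^sup>2"
    using norm_cauchy_schwarz[of b a] by (simp add: inner_diff_left power2_norm_eq_inner mult_ac)
  then have "3 * norm a * ((b - a) \<bullet> a) \<le> 3 * norm a * (norm a * norm b - (norm a)\<^sup>2)"
    by (intro mult_left_mono) auto
  moreover have "0 \<le> (norm b - norm a)\<^sup>2 * (norm b + 2 * norm a)"
    by simp
  ultimately show ?thesis
    by (simp add: power2_eq_square power3_eq_cube algebra_simps)
qed

text \<open>This is convexity of the regularised model on \<open>S\<close>: the quadratic part
  contributes through \<open>hessian_psd\<close>, the regulariser through the tangent inequality for
  the cubed norm.\<close>

lemma (in convex_lipschitz_hessian) cubic_part_above_tangent: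
  assumes x: "x \<in> S" and u: "u \<in> S" and v: "v \<in> S"
  shows "cubic_part f \<beta>2 x u + (v - u) \<bullet> gradient (cubic_part f \<beta>2 x) u \<le> cubic_part f \<beta>2 x v"
proof (cases "u = v")
  case False
  have "0 \<le> \<beta>2"
    using lipschitz_const_nonneg u v False by blast
  then have "\<beta>2 / 6 * (norm (u - x) ^ 3 + 3 * norm (u - x) * ((v - u) \<bullet> (u - x)))
      \<le> \<beta>2 / 6 * norm (v - x) ^ 3"
    using norm_cube_above_tangent[of "u - x" "v - x"] by (intro mult_left_mono) auto
  moreover have "(v - u) \<bullet> gradient (cubic_part f \<beta>2 x) u
      = (v - u) \<bullet> gradient (quad_part f x) u + \<beta>2 / 6 * (3 * norm (u - x) * ((v - u) \<bullet> (u - x)))"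
    by (simp only: inner_gradient[OF has_derivative_cubic_part]
        inner_gradient[OF has_derivative_quad_part])
  moreover have "quad_part f x u + (v - u) \<bullet> gradient (quad_part f x) u \<le> quad_part f x v"
    using hessian_psd[OF x u v] quad_part_expansion[of f x v u] by simp
  ultimately show ?thesis
    by (simp add: cubic_part_def distrib_left)
qed simp

lemma descent_lemma:
  fixes Q :: "'a::euclidean_space \<Rightarrow> real"
  assumes S: "convex S" and diff: "\<And>u. u \<in> S \<Longrightarrow> Q differentiable (at u)"
    and lip: "L-lipschitz_on S (gradient Q)" and y: "y \<in> S" and z: "z \<in> S"
  shows "Q z \<le> Q y + (z - y) \<bullet> gradient Q y + L / 2 * (norm (z - y))\<^sup>2"
proof -
  define d where "d = z - y"
  \<comment> \<open>\<open>k\<close> is \<open>Q\<close> along the segment minus the linear and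
    quadratic terms of the claimed bound. The Lipschitz condition on the gradient makes it
    nonincreasing.\<close>
  define k where "k s = Q (y + s *\<^sub>R d) - s * (d \<bullet> gradient Q y) - L * s\<^sup>2 / 2 * (norm d)\<^sup>2" for s
  have "k 1 \<le> k 0"
  proof (rule DERIV_nonpos_imp_nonincreasing[of 0 1 k])
    fix s :: real
    assume s: "0 \<le> s" "s \<le> 1"
    have seg: "y + s *\<^sub>R d \<in> S"
      unfolding d_def using S y z s by (rule segment_mem)
    have "(k has_real_derivative d \<bullet> gradient Q (y + s *\<^sub>R d) - d \<bullet> gradient Q y
        - L * s * (norm d)\<^sup>2) (at s)"
      unfolding k_def by (auto intro!: derivative_eq_intros DERIV_line diff[OF seg])
    moreover have "d \<bullet> gradient Q (y + s *\<^sub>R d) - d \<bullet> gradient Q y \<le> L * s * (norm d)\<^sup>2"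
    proof -
      have "d \<bullet> gradient Q (y + s *\<^sub>R d) - d \<bullet> gradient Q y
          = d \<bullet> (gradient Q (y + s *\<^sub>R d) - gradient Q y)"
        by (simp add: inner_diff_right)
      also have "\<dots> \<le> norm d * norm (gradient Q (y + s *\<^sub>R d) - gradient Q y)"
        by (rule norm_cauchy_schwarz)
      also have "\<dots> \<le> norm d * (L * (s * norm d))"
        using lipschitz_onD[OF lip seg y] s by (intro mult_left_mono) (auto simp: dist_norm)
      finally show ?thesis
        by (simp add: power2_eq_square mult_ac)
    qed
    ultimately show "\<exists>t. (k has_real_derivative t) (at s) \<and> t \<le> 0"
      by force
  qed simp
  then show ?thesis
    by (simp add: k_def d_def)
qed


subsection \<open>The weak proximal step\<close>

text \<open>\<open>real_of_ereal\<close> sends infinite values to 0, so real arithmetic with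
  \<open>R\<close> is faithful only on the domain. This is why membership of every point is tracked
  below.\<close>

lemma proper_closed_convex_ereal:
  assumes "proper_closed_convex R" "x \<in> effdom R"
  shows "R x = ereal (real_of_ereal (R x))"
  using assms by (cases "R x") (auto simp: proper_closed_convex_def effdom_def)

lemma composite_ereal:
  assumes "proper_closed_convex R" "x \<in> effdom R"
  shows "composite Q R x = ereal (Q x + real_of_ereal (R x))"
  unfolding composite_def by (subst proper_closed_convex_ereal[OF assms]) simp

lemma proper_closed_convex_convexD:
  assumes R: "proper_closed_convex R" and x: "x \<in> effdom R" and z: "z \<in> effdom R"
    and s: "0 \<le> s" "s \<le> 1"
  defines "r \<equiv> \<lambda>x. real_of_ereal (R x)"
  shows "(1 - s) *\<^sub>R x + s *\<^sub>R z \<in> effdom R"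
    and "r ((1 - s) *\<^sub>R x + s *\<^sub>R z) \<le> (1 - s) * r x + s * r z"
proof -
  let ?p = "(1 - s) *\<^sub>R x + s *\<^sub>R z"
  have "(x, r x) \<in> ereal_epigraph R" "(z, r z) \<in> ereal_epigraph R"
    unfolding ereal_epigraph_def r_def
    using proper_closed_convex_ereal[OF R x] proper_closed_convex_ereal[OF R z] by auto
  then have "(1 - s) *\<^sub>R (x, r x) + s *\<^sub>R (z, r z) \<in> ereal_epigraph R"
    using R s unfolding proper_closed_convex_def by (intro convexD_alt) auto
  then have le: "R ?p \<le> ereal ((1 - s) * r x + s * r z)"
    by (simp add: ereal_epigraph_def)
  then show p: "?p \<in> effdom R"
    using le_less_trans by (auto simp: effdom_def)
  show "r ?p \<le> (1 - s) * r x + s * r z"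
    using le proper_closed_convex_ereal[OF R p] unfolding r_def by (metis ereal_less_eq(3))
qed

text \<open>Since \<open>y' - y = l *\<^sub>R (w - y)\<close>, smoothness costs
  \<open>L / 2 * l\<^sup>2 * (norm (w - y))\<^sup>2\<close>. This is \<open>l\<close> times the
  proximal term of the oracle objective at \<open>w\<close>, so multiplying the comparison with
  \<open>xs\<close> by \<open>l\<close> removes \<open>w\<close> altogether.\<close>

lemma weak_prox_step:
  assumes R: "proper_closed_convex R" and wpo: "weak_prox_oracle Q R L xs \<A>"
    and y: "y \<in> effdom R" and xs: "xs \<in> effdom R" and l: "0 \<le> l" "l \<le> 1"
    and smooth: "\<And>z. z \<in> effdom R \<Longrightarrow> Q z \<le> Q y + (z - y) \<bullet> gradient Q y + L / 2 * (norm (z - y))\<^sup>2"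
    and y': "y' = (1 - l) *\<^sub>R y + l *\<^sub>R \<A> y l"
  defines "r \<equiv> \<lambda>x. real_of_ereal (R x)"
  shows "y' \<in> effdom R"
    and "Q y' + r y' \<le> (1 - l) * (Q y + r y)
      + l * (Q y + (xs - y) \<bullet> gradient Q y + l * L / 2 * (norm (xs - y))\<^sup>2 + r xs)"
proof -
  define w where "w = \<A> y l"
  have w: "w \<in> effdom R"
    and psi: "prox_objective Q R L y l w \<le> prox_objective Q R L y l xs"
    using wpo y l unfolding weak_prox_oracle_def w_def by auto
  show y'_dom: "y' \<in> effdom R"
    unfolding y' w_def[symmetric] by (rule proper_closed_convex_convexD(1)[OF R y w l])
  have ry': "r y' \<le> (1 - l) * r y + l * r w"
    unfolding y' w_def[symmetric] r_def by (rule proper_closed_convex_convexD(2)[OF R y w l])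
  have "(w - y) \<bullet> gradient Q y + l * L / 2 * (norm (w - y))\<^sup>2 + r w
      \<le> (xs - y) \<bullet> gradient Q y + l * L / 2 * (norm (xs - y))\<^sup>2 + r xs"
    using psi proper_closed_convex_ereal[OF R w] proper_closed_convex_ereal[OF R xs]
    unfolding prox_objective_def r_def by (metis plus_ereal.simps(1) ereal_less_eq(3))
  then have psi': "l * ((w - y) \<bullet> gradient Q y + l * L / 2 * (norm (w - y))\<^sup>2 + r w)
      \<le> l * ((xs - y) \<bullet> gradient Q y + l * L / 2 * (norm (xs - y))\<^sup>2 + r xs)"
    using l by (intro mult_left_mono)
  have "y' - y = l *\<^sub>R (w - y)"
    by (simp add: y' w_def algebra_simps)
  then have "Q y' \<le> Q y + l * ((w - y) \<bullet> gradient Q y) + L / 2 * (l\<^sup>2 * (norm (w - y))\<^sup>2)"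
    using smooth[OF y'_dom] by (simp add: power_mult_distrib)
  with ry' psi' show "Q y' + r y' \<le> (1 - l) * (Q y + r y)
      + l * (Q y + (xs - y) \<bullet> gradient Q y + l * L / 2 * (norm (xs - y))\<^sup>2 + r xs)"
    by (simp add: power2_eq_square algebra_simps)
qed


subsection \<open>Convergence of the iterates\<close>

locale composite_problem_at =
  fixes f :: "'a::euclidean_space \<Rightarrow> real" and R :: "'a \<Rightarrow> ereal"
    and \<beta>2 :: real and xs xt :: 'a
  assumes problem: "composite_problem f R \<beta>2 xs"
    and xt: "xt \<in> effdom R"
begin

abbreviation r :: "'a \<Rightarrow> real" where
  "r x \<equiv> real_of_ereal (R x)"

lemma R: "proper_closed_convex R"
  using problem by (simp add: composite_problem_def)

sublocale convex_lipschitz_hessian f "effdom R" \<beta>2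
  using problem by unfold_locales (auto simp: composite_problem_def)

lemma minimal: "composite f R xs \<le> composite f R z"
  using problem by (simp add: composite_problem_def unique_minimizer_def)

lemma xs: "xs \<in> effdom R"
proof -
  have "composite f R xs < \<infinity>"
    using minimal[of xt] composite_ereal[OF R xt, of f]
    by (cases "composite f R xs") auto
  then show ?thesis
    by (auto simp: effdom_def composite_def)
qed

lemma opt_value_eq: "opt_value f R = composite f R xs"
  unfolding opt_value_def using minimal by (intro antisym INF_lower INF_greatest) auto

lemma iterates_mem:
  assumes "weak_prox_oracle Q R L xs \<A>" "wpno_run \<A> xt \<eta> y" "1 \<le> i"
  shows "y i \<in> effdom R"
  using assms(3)
proof (induction i rule: dec_induct)
  case base
  show ?case
    using assms(2) xt by (simp add: wpno_run_def)
next
  case (step i)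
  then have "\<A> (y i) (\<eta> i) \<in> effdom R" and "0 \<le> \<eta> i" "\<eta> i \<le> 1"
    using assms by (auto simp: weak_prox_oracle_def wpno_run_def)
  then show ?case
    using assms(2) step proper_closed_convex_convexD(1)[OF R] by (simp add: wpno_run_def)
qed

lemma quad_model_rate:
  fixes y :: "nat \<Rightarrow> 'a"
  assumes pos: "0 < \<beta>"
    and upper: "loewner_le (hessian f xt) (\<beta> *\<^sub>R id_blinfun)"
    and lower: "loewner_le (\<alpha> *\<^sub>R id_blinfun) (hessian f xt)"
    and wpo: "weak_prox_oracle (quad_part f xt) R \<beta> xs \<A>"
    and run: "wpno_run \<A> xt \<eta> y" and \<eta>: "\<And>i. 1 \<le> i \<Longrightarrow> \<eta> i = \<alpha> / \<beta>" and i: "1 \<le> i"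
  defines "\<phi> \<equiv> \<lambda>x. quad_part f xt x + r x"
  shows "\<phi> (y i) - \<phi> xs
    \<le> (f xt + r xt - (f xs + r xs) + \<beta>2 / 6 * norm (xt - xs) ^ 3) * (1 - \<alpha> / \<beta>) ^ (i - 1)"
  using i
proof (induction i rule: dec_induct)
  case base
  have "y 1 = xt"
    using run by (simp add: wpno_run_def)
  \<comment> \<open>The model's differentiable part vanishes at its centre \<open>xt\<close>, so the
    Taylor error at \<open>xs\<close> is the only error. It enters once, in the initial gap.\<close>
  moreover have "f xs - f xt - quad_part f xt xs \<le> \<beta>2 / 6 * norm (xt - xs) ^ 3"
    using quad_part_approx[OF xt xs] unfolding norm_minus_commute[of xs xt] by linarith
  ultimately show ?case
    by (simp add: \<phi>_def quad_part_def[of f xt xt])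
next
  case (step i)
  define l where "l = \<alpha> / \<beta>"
  \<comment> \<open>The bound \<open>l \<le> 1\<close> is read off from the admissible step-sizes of
    the run.\<close>
  have l: "0 \<le> l" "l \<le> 1" and y': "y (Suc i) = (1 - l) *\<^sub>R y i + l *\<^sub>R \<A> (y i) l"
    using run \<eta>[OF step(1)] step(1) by (auto simp: wpno_run_def l_def)
  have y: "y i \<in> effdom R"
    using iterates_mem[OF wpo run step(1)] .
  have smooth: "quad_part f xt z \<le> quad_part f xt (y i) + (z - y i) \<bullet> gradient (quad_part f xt) (y i)
      + \<beta> / 2 * (norm (z - y i))\<^sup>2" for z
    using upper quad_part_expansion[of f xt z "y i"]
    by (simp add: loewner_le_def blinfun.scaleR_left power2_norm_eq_inner)
  have "\<alpha> / 2 * (norm (xs - y i))\<^sup>2 \<le> 1 / 2 * ((xs - y i) \<bullet> hessian f xt (xs - y i))"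
    using lower by (simp add: loewner_le_def blinfun.scaleR_left power2_norm_eq_inner)
  then have "quad_part f xt (y i) + (xs - y i) \<bullet> gradient (quad_part f xt) (y i)
      + l * \<beta> / 2 * (norm (xs - y i))\<^sup>2 + r xs \<le> \<phi> xs"
    using quad_part_expansion[of f xt xs "y i"] pos by (simp add: l_def \<phi>_def)
  from mult_left_mono[OF this l(1)]
  have "\<phi> (y (Suc i)) \<le> (1 - l) * \<phi> (y i) + l * \<phi> xs"
    using weak_prox_step(2)[OF R wpo y xs l smooth y'] unfolding \<phi>_def by linarith
  then have "\<phi> (y (Suc i)) - \<phi> xs \<le> (\<phi> (y i) - \<phi> xs) * (1 - l)"
    by (simp add: algebra_simps)
  also have "\<dots> \<le> ((f xt + r xt - (f xs + r xs) + \<beta>2 / 6 * norm (xt - xs) ^ 3) * (1 - l) ^ (i - 1))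
      * (1 - l)"
    using step.IH l unfolding l_def by (intro mult_right_mono) auto
  \<comment> \<open>Natural subtraction is truncated at 0, so raising the exponent by one relies on
    \<open>i \<ge> 1\<close>.\<close>
  also have "\<dots> = (f xt + r xt - (f xs + r xs) + \<beta>2 / 6 * norm (xt - xs) ^ 3) * (1 - l) ^ (Suc i - 1)"
    using step(1) by (cases i) auto
  finally show ?case
    by (simp add: l_def)
qed

lemma cubic_model_rate:
  fixes y :: "nat \<Rightarrow> 'a"
  assumes pos: "0 < \<alpha>"
    and growth: "\<And>x. x \<in> effdom R \<Longrightarrow>
      (norm (x - xs))\<^sup>2 \<le> 2 / \<alpha> * (f x + r x - (f xs + r xs))"
    and L: "L-lipschitz_on (effdom R) (gradient (cubic_part f \<beta>2 xt))"
    and wpo: "weak_prox_oracle (cubic_part f \<beta>2 xt) R L xs \<A>"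
    and run: "wpno_run \<A> xt \<eta> y" and \<eta>: "\<And>i. 1 \<le> i \<Longrightarrow> \<eta> i = \<alpha> / (2 * L)" and i: "1 \<le> i"
  defines "\<phi> \<equiv> \<lambda>x. cubic_part f \<beta>2 xt x + r x"
  shows "\<phi> (y i) - \<phi> xs
    \<le> (f xt + r xt - (f xs + r xs)) * (1 - \<alpha> / (4 * L)) ^ (i - 1) + \<beta>2 / 3 * norm (xt - xs) ^ 3"
proof -
  define Q where "Q = cubic_part f \<beta>2 xt"
  \<comment> \<open>\<delta> is twice \<open>\<beta>2 / 6 * norm (xt - xs) ^ 3\<close>: once for the
    Taylor error at \<open>xs\<close>, once for the regulariser there.\<close>
  define \<delta> where "\<delta> = \<beta>2 / 3 * norm (xt - xs) ^ 3"
  define l where "l = \<alpha> / (2 * L)"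
  have l: "0 \<le> l" "l \<le> 1"
    using run \<eta>[of 1] by (auto simp: wpno_run_def l_def)
  have \<delta>: "0 \<le> \<delta>"
    using lipschitz_const_nonneg[OF xt xs] by (cases "xt = xs") (auto simp: \<delta>_def)
  \<comment> \<open>The regulariser absorbs the Taylor error, so the model majorises
    \<open>f - f xt\<close> on the whole domain. In the transfer of quadratic growth, an error
    therefore arises only at \<open>xs\<close>.\<close>
  have above: "f x - f xt \<le> Q x" if "x \<in> effdom R" for x
    using quad_part_approx[OF xt that] unfolding Q_def cubic_part_def by linarith
  have below: "Q xs \<le> f xs - f xt + \<delta>"
    using quad_part_approx[OF xt xs]
    unfolding Q_def cubic_part_def \<delta>_def norm_minus_commute[of xs xt] by linarith
  \<comment> \<open>With gap \<open>e\<close>, the step yields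
    \<open>e' \<le> (1 - l) * e + l / 2 * (e + \<delta>)\<close>: half of the decrease pays for the
    proximal term. The fixed point of this recursion is \<delta>, so \<open>e - \<delta>\<close>
    contracts by \<open>1 - l / 2\<close>.\<close>
  have "\<phi> (y i) - \<phi> xs - \<delta> \<le> (f xt + r xt - (f xs + r xs)) * (1 - l / 2) ^ (i - 1)"
    using i
  proof (induction i rule: dec_induct)
    case base
    have "y 1 = xt"
      using run by (simp add: wpno_run_def)
    moreover have "Q xt = 0"
      by (simp add: Q_def cubic_part_def quad_part_def)
    ultimately show ?case
      using above[OF xs] \<delta> by (simp add: \<phi>_def Q_def[symmetric])
  next
    case (step i)
    have y': "y (Suc i) = (1 - l) *\<^sub>R y i + l *\<^sub>R \<A> (y i) l"
      using run \<eta>[OF step(1)] step(1) by (auto simp: wpno_run_def l_def)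
    have y: "y i \<in> effdom R"
      using iterates_mem[OF wpo run step(1)] .
    have smooth: "Q z \<le> Q (y i) + (z - y i) \<bullet> gradient Q (y i) + L / 2 * (norm (z - y i))\<^sup>2"
      if "z \<in> effdom R" for z
      using convex_S differentiableI[OF has_derivative_cubic_part] L y that
      unfolding Q_def by (rule descent_lemma)
    have growth': "\<alpha> / 2 * (norm (y i - xs))\<^sup>2 \<le> \<phi> (y i) - \<phi> xs + \<delta>"
    proof -
      have "\<alpha> / 2 * (norm (y i - xs))\<^sup>2 \<le> f (y i) + r (y i) - (f xs + r xs)"
        using mult_left_mono[OF growth[OF y], of "\<alpha> / 2"] pos by simp
      also have "\<dots> \<le> \<phi> (y i) - \<phi> xs + \<delta>"
        using above[OF y] below by (simp add: \<phi>_def Q_def[symmetric])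
      finally show ?thesis .
    qed
    \<comment> \<open>If \<open>L = 0\<close>, then \<open>l = \<alpha> / 0 = 0\<close> and both sides vanish.\<close>
    have "l * (l * L / 2 * (norm (xs - y i))\<^sup>2) = l / 2 * (\<alpha> / 2 * (norm (y i - xs))\<^sup>2)"
      by (cases "L = 0") (simp_all add: l_def norm_minus_commute)
    also have "\<dots> \<le> l / 2 * (\<phi> (y i) - \<phi> xs + \<delta>)"
      using l growth' by (intro mult_left_mono) auto
    finally have quad: "l * (l * L / 2 * (norm (xs - y i))\<^sup>2) \<le> l / 2 * (\<phi> (y i) - \<phi> xs + \<delta>)" .
    have "l * (Q (y i) + (xs - y i) \<bullet> gradient Q (y i)) \<le> l * Q xs"
      unfolding Q_def using l cubic_part_above_tangent[OF xt y xs] by (intro mult_left_mono)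
    then have "\<phi> (y (Suc i)) \<le> (1 - l) * \<phi> (y i) + l * \<phi> xs + l / 2 * (\<phi> (y i) - \<phi> xs + \<delta>)"
      using weak_prox_step(2)[OF R wpo[folded Q_def] y xs l smooth y'] quad
      unfolding \<phi>_def Q_def[symmetric] by (simp add: algebra_simps)
    then have "\<phi> (y (Suc i)) - \<phi> xs - \<delta> \<le> (\<phi> (y i) - \<phi> xs - \<delta>) * (1 - l / 2)"
      by (simp add: field_simps)
    also have "\<dots> \<le> ((f xt + r xt - (f xs + r xs)) * (1 - l / 2) ^ (i - 1)) * (1 - l / 2)"
      using step.IH l by (intro mult_right_mono) auto
    also have "\<dots> = (f xt + r xt - (f xs + r xs)) * (1 - l / 2) ^ (Suc i - 1)"
      using step(1) by (cases i) auto
    finally show ?case .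
  qed
  then show ?thesis
    by (simp add: l_def \<delta>_def)
qed

end

theorem theorem2:
  fixes f :: "'a::euclidean_space \<Rightarrow> real" and R :: "'a \<Rightarrow> ereal"
    and \<beta>2 :: real and xstar x1 xt :: 'a
  assumes "composite_problem f R \<beta>2 xstar"
    and "x1 \<in> effdom R" and "xt \<in> effdom R" and "composite f R xt \<le> composite f R x1"
  shows
    "(\<forall>\<alpha> \<beta> \<beta>t \<phi> \<A> \<eta> y.
        assumption_A f R x1 \<alpha> \<beta> \<and>
        \<phi> = composite (quad_part f xt) R \<and>
        \<beta>t = \<beta> \<and>
        weak_prox_oracle (quad_part f xt) R \<beta>t xstar \<A> \<and>
        wpno_run \<A> xt \<eta> y \<and> (\<forall>i\<ge>1. \<eta> i = \<alpha> / \<beta>t) \<longrightarrow>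
        (\<forall>i\<ge>1. \<phi> (y i) - \<phi> xstar
            \<le> (composite f R xt - opt_value f R + ereal (\<beta>2 / 6 * norm (xt - xstar) ^ 3))
               * ereal ((1 - \<alpha> / \<beta>t) ^ (i - 1)))) \<and>
     (\<forall>\<alpha> \<beta> \<beta>t \<phi> \<A> \<eta> y.
        assumption_B f R xstar \<alpha> \<beta> \<and>
        \<phi> = composite (cubic_part f \<beta>2 xt) R \<and>
        \<beta>t = \<beta> + \<beta>2 * diameter (effdom R) / 2 \<and>
        \<beta>t-lipschitz_on (effdom R) (gradient (cubic_part f \<beta>2 xt)) \<and>
        weak_prox_oracle (cubic_part f \<beta>2 xt) R \<beta>t xstar \<A> \<and>
        wpno_run \<A> xt \<eta> y \<and> (\<forall>i\<ge>1. \<eta> i = \<alpha> / (2 * \<beta>t)) \<longrightarrow>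
        (\<forall>i\<ge>1. \<phi> (y i) - \<phi> xstar
            \<le> (composite f R xt - opt_value f R) * ereal ((1 - \<alpha> / (4 * \<beta>t)) ^ (i - 1))
               + ereal (\<beta>2 / 3 * norm (xt - xstar) ^ 3)))"
proof -
  interpret composite_problem_at f R \<beta>2 xstar xt
    using assms by unfold_locales
  \<comment> \<open>All values involved are taken at domain points and hence finite, so the
    extended-real claims reduce to the real rates.\<close>
  note ereals = composite_ereal[OF R] opt_value_eq
  show ?thesis
  proof (rule conjI; intro allI impI; elim conjE)
    fix \<alpha> \<beta> \<beta>t :: real and \<phi> \<A> \<eta> and y :: "nat \<Rightarrow> 'a" and i :: nat
    assume A: "assumption_A f R x1 \<alpha> \<beta>" and \<phi>: "\<phi> = composite (quad_part f xt) R"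
      and \<beta>t: "\<beta>t = \<beta>" and wpo: "weak_prox_oracle (quad_part f xt) R \<beta>t xstar \<A>"
      and run: "wpno_run \<A> xt \<eta> y" and \<eta>: "\<forall>i\<ge>1. \<eta> i = \<alpha> / \<beta>t" and i: "1 \<le> i"
    \<comment> \<open>\<open>xt\<close> lies in the initial level set because its objective value
      does not exceed that of \<open>x1\<close>. The model's Hessian is constant, so the bounds at
      \<open>xt\<close> suffice.\<close>
    have "0 < \<beta>t" "loewner_le (hessian f xt) (\<beta>t *\<^sub>R id_blinfun)"
      "loewner_le (\<alpha> *\<^sub>R id_blinfun) (hessian f xt)"
      using A assms(4) by (auto simp: assumption_A_def \<beta>t)
    note rate = quad_model_rate[OF this wpo run _ i]
    show "\<phi> (y i) - \<phi> xstar
        \<le> (composite f R xt - opt_value f R + ereal (\<beta>2 / 6 * norm (xt - xstar) ^ 3))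
           * ereal ((1 - \<alpha> / \<beta>t) ^ (i - 1))"
      using rate \<eta> by (simp add: \<phi> ereals xt xs iterates_mem[OF wpo run i])
  next
    fix \<alpha> \<beta> \<beta>t :: real and \<phi> \<A> \<eta> and y :: "nat \<Rightarrow> 'a" and i :: nat
    assume B: "assumption_B f R xstar \<alpha> \<beta>" and \<phi>: "\<phi> = composite (cubic_part f \<beta>2 xt) R"
      and L: "\<beta>t-lipschitz_on (effdom R) (gradient (cubic_part f \<beta>2 xt))"
      and wpo: "weak_prox_oracle (cubic_part f \<beta>2 xt) R \<beta>t xstar \<A>"
      and run: "wpno_run \<A> xt \<eta> y" and \<eta>: "\<forall>i\<ge>1. \<eta> i = \<alpha> / (2 * \<beta>t)" and i: "1 \<le> i"
    have "0 < \<alpha>"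
      using B by (simp add: assumption_B_def)
    moreover have "(norm (x - xstar))\<^sup>2 \<le> 2 / \<alpha> * (f x + r x - (f xstar + r xstar))"
      if x: "x \<in> effdom R" for x
      using B x by (auto simp: assumption_B_def ereals xs)
    ultimately have rate: "cubic_part f \<beta>2 xt (y i) + r (y i) - (cubic_part f \<beta>2 xt xstar + r xstar)
        \<le> (f xt + r xt - (f xstar + r xstar)) * (1 - \<alpha> / (4 * \<beta>t)) ^ (i - 1)
          + \<beta>2 / 3 * norm (xt - xstar) ^ 3"
      using \<eta> by (intro cubic_model_rate[OF _ _ L wpo run _ i]) auto
    show "\<phi> (y i) - \<phi> xstar
        \<le> (composite f R xt - opt_value f R) * ereal ((1 - \<alpha> / (4 * \<beta>t)) ^ (i - 1))
           + ereal (\<beta>2 / 3 * norm (xt - xstar) ^ 3)"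
      using rate by (simp add: \<phi> ereals xt xs iterates_mem[OF wpo run i])
  qed
qed

end
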